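(* There is an absolute constant $C$ such that for any set $\Omega$, any class $F \subset B(L_\infty(\Omega))$, any positive integer $n$, every empirical measure $\mu_n$ supported on $n$ points of $\Omega$ and every $t>0$, $$\log N\big(F, L_2(\mu_n), t\big) \le C\,\mathrm{fat}_{t/8}(F)\,\log^2\frac{2}{t}.$$
   Context: $B(L_\infty(\Omega))$ is the set of functions $f:\Omega\to\mathbb{R}$ with $\sup_{x \in \Omega}|f(x)|\le 1$. For points $x_1,\dots,x_n\in\Omega$, the empirical measure is $\mu_n = n^{-1}\sum_{i=1}^n\delta_{x_i}$, so that $\|f\|_{L_2(\mu_n)}=\big(n^{-1}\sum_{i=1}^n f(x_i)^2\big)^{1/2}$. $N(F,L_2(\mu_n),t)$ is the minimal number of closed balls of radius $t$ in $L_2(\mu_n)$ (centers arbitrary in $L_2(\mu_n)$) needed to cover $F$. For $\varepsilon>0$, a finite set $A=\{y_1,\dots,y_m\}\subset\Omega$ is $\varepsilon$-shattered by $F$ if there is a function $\gamma:A\to\mathbb{R}$ such that for every $I\subset\{1,\dots,m\}$ there is $f_I\in F$ with $f_I(y_i)\ge\gamma(y_i)+\varepsilon$ if $i\in I$ and $f_I(y_i)\le\gamma(y_i)-\varepsilon$ if $i\notin I$. The fat-shattering dimension is $\mathrm{fat}_\varepsilon(F)=\sup\{|A| : A\subset\Omega \text{ is } \varepsilon\text{-shattered by } F\}\in\{0,1,2,\dots\}\cup\{\infty\}$. *)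

theory Defs
  imports "HOL-Probability.Probability"
begin

text \<open>Functions on \<open>\<Omega> :: 'a set\<close> are total functions on \<open>'a\<close>; their values outside \<open>\<Omega>\<close>
  play no role in any of the notions below.\<close>

definition Linf_unit_ball :: "'a set \<Rightarrow> ('a \<Rightarrow> real) set" where
  "Linf_unit_ball \<Omega> = {f. (SUP x\<in>\<Omega>. ereal \<bar>f x\<bar>) \<le> 1}"

text \<open>The points \<open>x 1, \<dots>, x n\<close> need not be distinct: push-forward under \<open>x\<close> of the uniform
  distribution on \<open>{1..n}\<close> counts repeated points with multiplicity.\<close>

definition empirical_measure :: "nat \<Rightarrow> (nat \<Rightarrow> 'a) \<Rightarrow> 'a measure" where
  "empirical_measure n x = measure_pmf (map_pmf x (pmf_of_set {1..n}))"

definition L2_space :: "'a measure \<Rightarrow> ('a \<Rightarrow> real) set" where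
  "L2_space M = {g \<in> borel_measurable M. integrable M (\<lambda>x. (g x)\<^sup>2)}"

definition L2_seminorm :: "'a measure \<Rightarrow> ('a \<Rightarrow> real) \<Rightarrow> real" where
  "L2_seminorm M f = sqrt (\<integral>x. (f x)\<^sup>2 \<partial>M)"

definition L2_cball :: "'a measure \<Rightarrow> ('a \<Rightarrow> real) \<Rightarrow> real \<Rightarrow> ('a \<Rightarrow> real) set" where
  "L2_cball M g t = {f \<in> L2_space M. L2_seminorm M (\<lambda>x. f x - g x) \<le> t}"

text \<open>Infimum in \<open>enat\<close>: it is \<open>\<infinity>\<close> if there is no finite cover.\<close>

definition covering_number :: "'a measure \<Rightarrow> ('a \<Rightarrow> real) set \<Rightarrow> real \<Rightarrow> enat" where
  "covering_number M F t =
     Inf {enat (card G) | G. finite G \<and> G \<subseteq> L2_space M \<and> F \<subseteq> (\<Union>g\<in>G. L2_cball M g t)}"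

definition ln_enat :: "enat \<Rightarrow> ereal" where
  "ln_enat N = (case N of enat k \<Rightarrow> (if k = 0 then -\<infinity> else ereal (ln (real k))) | \<infinity> \<Rightarrow> \<infinity>)"

definition shattered :: "real \<Rightarrow> ('a \<Rightarrow> real) set \<Rightarrow> 'a set \<Rightarrow> bool" where
  "shattered \<epsilon> F A \<longleftrightarrow>
     (\<exists>\<gamma>. \<forall>I\<subseteq>A. \<exists>f\<in>F. (\<forall>y\<in>I. f y \<ge> \<gamma> y + \<epsilon>) \<and> (\<forall>y\<in>A - I. f y \<le> \<gamma> y - \<epsilon>))"

definition fat :: "'a set \<Rightarrow> real \<Rightarrow> ('a \<Rightarrow> real) set \<Rightarrow> enat" where
  "fat \<Omega> \<epsilon> F = Sup {enat (card A) | A. finite A \<and> A \<subseteq> \<Omega> \<and> shattered \<epsilon> F A}"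

text \<open>The entropy estimate with constant \<open>C\<close> for all classes on the set \<open>\<Omega>\<close>. In the degenerate
  case \<open>t = 2\<close> with infinite \<open>fat\<close>, the right-hand side is \<open>0\<close> because \<open>\<infinity> * 0 = 0\<close> in
  \<open>ereal\<close>.\<close>

definition entropy_bound :: "real \<Rightarrow> 'a set \<Rightarrow> bool" where
  "entropy_bound C \<Omega> \<longleftrightarrow>
     (\<forall>F n x t. F \<subseteq> Linf_unit_ball \<Omega> \<longrightarrow> n > 0 \<longrightarrow> x ` {1..n} \<subseteq> \<Omega> \<longrightarrow> t > 0 \<longrightarrow>
        ln_enat (covering_number (empirical_measure n x) F t)
          \<le> ereal C * ereal_of_enat (fat \<Omega> (t / 8) F) * ereal ((ln (2 / t))\<^sup>2))"

text \<open>A constant is absolute if it serves for subsets of every type. HOL has no quantifier over types,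
  and in \<open>\<exists>C>0. \<forall>\<Omega> :: 'a set. entropy_bound C \<Omega>\<close> the constant could depend on \<open>'a\<close>. Uniformity
  over all types is therefore stated in two parts: some constant serves for all \<open>\<Omega> :: nat set\<close> (no
  type variable, so nothing for it to depend on), and every such constant also serves for all \<open>\<Omega> :: 'a set\<close>
  with \<open>'a\<close> arbitrary.\<close>

lemma measure_empirical_measure:
  assumes "n > 0"
  shows "measure (empirical_measure n x) A = (\<Sum>i=1..n. indicator A (x i)) / n"
proof -
  have "(\<Sum>i=1..n. indicator A (x i)) = real (card ({1..n} \<inter> x -` A))"
    by (simp add: indicator_def sum.If_cases Int_def)
  then show ?thesis
    using assms by (simp add: empirical_measure_def measure_pmf_of_set)
qed

lemma L2_seminorm_empirical_measure:
  assumes "n > 0"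
  shows "L2_seminorm (empirical_measure n x) f = sqrt ((\<Sum>i=1..n. (f (x i))\<^sup>2) / n)"
  using assms by (simp add: L2_seminorm_def empirical_measure_def integral_pmf_of_set)

lemma L2_space_empirical_measure:
  assumes "n > 0"
  shows "L2_space (empirical_measure n x) = UNIV"
  using assms by (auto simp: L2_space_def empirical_measure_def intro!: integrable_measure_pmf_finite)

end

theory Submission
  imports Defs
begin

text \<open>
  Let \<open>G\<close> be a maximal subset of \<open>F\<close> whose members have pairwise \<open>L\<^sub>2(\<mu>\<^sub>n)\<close>-distance more than \<open>t\<close>.
  The balls of radius \<open>t\<close> around \<open>G\<close> cover \<open>F\<close>, so it suffices to bound \<open>L = ln (card G)\<close>
  in terms of \<open>d = fat\<^bsub>t/8\<^esub> F\<close>. For \<open>t \<ge> 1\<close> the single ball around \<open>0\<close> is a cover; let \<open>t < 1\<close>.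

  Shattered sets are counted together with their witnesses: a shattered pair is a set of points
  with a level at each of them, taken from a grid of step \<open>t / 8\<close>. The estimate comes from
  two bounds for the number of shattered pairs.

  The lower bound is the combinatorial argument of Alon, Ben-David, Cesa-Bianchi and Haussler, in a form
  adapted to the \<open>L\<^sub>2\<close>-distance. If every two functions of \<open>G\<close> are well apart at a proportion \<open>\<beta>\<close> of the points, then by averaging
  over points and levels some level at some point splits off an upper and a lower part of \<open>G\<close>, each of them a
  proportion \<open>\<alpha>\<close> of \<open>G\<close>, where \<open>\<alpha>\<close> is a power of \<open>t\<close> (\<open>ex_balanced_split\<close>). The shattered pairs of the two parts
  add up to at most those of \<open>G\<close>: a pair shattered by both becomes a new one when the splitting point
  is added to it (\<open>card_shattered_pairs_split\<close>). Each split thus doubles the count at the price of a factor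
  \<open>\<alpha>\<close> in the cardinality, and there are at least \<open>2 ^ D\<close> shattered pairs, where \<open>D\<close> is about \<open>L / ln (1 / \<alpha>)\<close>.

  The upper bound is Sauer's: on \<open>k\<close> points with \<open>b\<close> levels there are at most \<open>(e b k / d) ^ d\<close> pairs whose sets
  have at most \<open>d\<close> elements. It depends on the number of points, so the \<open>n\<close> points are first
  replaced by a sample of about \<open>L / t\<^sup>2 + d\<close> of them, on which all functions of \<open>G\<close> are still
  apart at a fixed proportion of the points (\<open>ex_sample_keeping_distances\<close>).

  With \<open>u = L / d\<close> the two bounds read \<open>u \<le> C ln (2 / t) (ln (2 / t) + ln (1 + u))\<close>, and
  this gives \<open>u \<le> C' (ln (2 / t))\<^sup>2\<close>. The argument works for every set \<open>\<Omega>\<close>. The passage from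
  \<open>nat\<close> to an arbitrary type with the same constant uses that the covering number depends only on the values at the finitely many points \<open>x i\<close>.
\<close>

section \<open>Shattered pairs\<close>

text \<open>The levels are a parameter here, unlike in \<open>shattered\<close>, because shattered sets are counted with their levels.\<close>

definition shattered_at :: "real \<Rightarrow> ('a \<Rightarrow> real) \<Rightarrow> ('a \<Rightarrow> real) set \<Rightarrow> 'a set \<Rightarrow> bool" where
  "shattered_at \<epsilon> \<gamma> F A \<longleftrightarrow>
     (\<forall>I\<subseteq>A. \<exists>f\<in>F. (\<forall>y\<in>I. f y \<ge> \<gamma> y + \<epsilon>) \<and> (\<forall>y\<in>A - I. f y \<le> \<gamma> y - \<epsilon>))"

text \<open>The levels are extensional on \<open>S\<close>, so that restricting them to a finite set \<open>M\<close> leaves finitely many pairs.\<close>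

definition shattered_pairs ::
  "real \<Rightarrow> real set \<Rightarrow> 'a set \<Rightarrow> ('a \<Rightarrow> real) set \<Rightarrow> ('a set \<times> ('a \<Rightarrow> real)) set" where
  "shattered_pairs \<epsilon> M J F = {(S, r). S \<subseteq> J \<and> r \<in> S \<rightarrow>\<^sub>E M \<and> shattered_at \<epsilon> r F S}"

definition separated_at ::
  "real \<Rightarrow> real set \<Rightarrow> ('a \<Rightarrow> real) \<Rightarrow> ('a \<Rightarrow> real) \<Rightarrow> 'a \<Rightarrow> bool" where
  "separated_at \<epsilon> M f g j \<longleftrightarrow>
     (\<exists>\<theta>\<in>M. f j \<ge> \<theta> + \<epsilon> \<and> g j \<le> \<theta> - \<epsilon> \<or> g j \<ge> \<theta> + \<epsilon> \<and> f j \<le> \<theta> - \<epsilon>)"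

lemma shattered_iff_shattered_at: "shattered \<epsilon> F A \<longleftrightarrow> (\<exists>\<gamma>. shattered_at \<epsilon> \<gamma> F A)"
  by (simp add: shattered_def shattered_at_def)

lemma shattered_at_mono: "shattered_at \<epsilon> \<gamma> F A \<Longrightarrow> F \<subseteq> G \<Longrightarrow> shattered_at \<epsilon> \<gamma> G A"
  unfolding shattered_at_def by (meson subsetD)

lemma shattered_atD:
  assumes "shattered_at \<epsilon> \<gamma> F A" "I \<subseteq> A"
  obtains f where "f \<in> F" "\<And>y. y \<in> I \<Longrightarrow> f y \<ge> \<gamma> y + \<epsilon>" "\<And>y. y \<in> A - I \<Longrightarrow> f y \<le> \<gamma> y - \<epsilon>"
  using assms unfolding shattered_at_def by meson

lemma shattered_pairs_mono: "F \<subseteq> G \<Longrightarrow> shattered_pairs \<epsilon> M J F \<subseteq> shattered_pairs \<epsilon> M J G"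
  by (auto simp: shattered_pairs_def intro: shattered_at_mono)

lemma shattered_pairs_subset_Sigma: "shattered_pairs \<epsilon> M J F \<subseteq> Sigma (Pow J) (\<lambda>S. S \<rightarrow>\<^sub>E M)"
  by (auto simp: shattered_pairs_def)

lemma finite_shattered_pairs:
  assumes "finite J" "finite M"
  shows "finite (shattered_pairs \<epsilon> M J F)"
  using assms
  by (intro finite_subset[OF shattered_pairs_subset_Sigma] finite_SigmaI)
     (auto intro: finite_PiE finite_subset)

text \<open>A pair \<open>(S, r)\<close> shattered by both parts is counted twice on the left. It cannot have \<open>j \<in> S\<close>: a
  level at \<open>j\<close> would have to lie above \<open>\<theta>\<close> for the upper part and below \<open>\<theta>\<close> for the lower one. Hence \<open>j\<close> with level \<open>\<theta>\<close>
  can be added to it; \<open>G\<close> shatters the larger pair by using the upper part for the sets containing \<open>j\<close>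
  and the lower part for the others, while neither part alone does.\<close>

lemma card_shattered_pairs_split:
  fixes G :: "('a \<Rightarrow> real) set"
  assumes fin: "finite J" "finite M" and "\<epsilon> > 0" and j: "j \<in> J" and \<theta>: "\<theta> \<in> M"
  defines "U \<equiv> {g \<in> G. g j \<ge> \<theta> + \<epsilon>}" and "L \<equiv> {g \<in> G. g j \<le> \<theta> - \<epsilon>}"
  shows "card (shattered_pairs \<epsilon> M J U) + card (shattered_pairs \<epsilon> M J L)
           \<le> card (shattered_pairs \<epsilon> M J G)"
proof -
  let ?P = "shattered_pairs \<epsilon> M J"
  define extend where "extend = (\<lambda>(S, r). (insert j S, r(j := \<theta>)))"
  have finP: "finite (?P F)" for F :: "('a \<Rightarrow> real) set"
    using fin by (rule finite_shattered_pairs)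
  \<comment> \<open>The patterns \<open>I = {}\<close> and \<open>I = S\<close> force values on both sides of the level at every point of \<open>S\<close>.\<close>
  have lo: "\<exists>f\<in>F. f j \<le> r j - \<epsilon>" and hi: "\<exists>f\<in>F. f j \<ge> r j + \<epsilon>"
    if "(S, r) \<in> ?P F" "j \<in> S" for S r and F :: "('a \<Rightarrow> real) set"
  proof -
    have sh: "shattered_at \<epsilon> r F S" using that by (simp add: shattered_pairs_def)
    show "\<exists>f\<in>F. f j \<le> r j - \<epsilon>"
      using shattered_atD[OF sh, of "{}"] that(2) by (metis Diff_empty empty_subsetI)
    show "\<exists>f\<in>F. f j \<ge> r j + \<epsilon>"
      using shattered_atD[OF sh, of S] that(2) by (metis subset_refl)
  qed
  have notin: "j \<notin> S" if "(S, r) \<in> ?P U \<inter> ?P L" for S r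
  proof
    assume jS: "j \<in> S"
    have "\<exists>f\<in>U. f j \<le> r j - \<epsilon>" "\<exists>g\<in>L. g j \<ge> r j + \<epsilon>"
      using that jS by (blast intro: lo hi)+
    then show False using \<open>\<epsilon> > 0\<close> by (auto simp: U_def L_def)
  qed
  have "inj_on extend (?P U \<inter> ?P L)"
  proof (rule inj_onI)
    fix p q assume p: "p \<in> ?P U \<inter> ?P L" and q: "q \<in> ?P U \<inter> ?P L" and eq: "extend p = extend q"
    obtain S r where pS: "p = (S, r)" by (cases p)
    obtain S' r' where qS: "q = (S', r')" by (cases q)
    have nS: "j \<notin> S" "j \<notin> S'" using notin p q pS qS by blast+
    have "S = S'" using eq nS by (auto simp: extend_def pS qS)
    moreover have "r = r'"
    proof
      fix i
      have "r j = undefined" "r' j = undefined"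
        using p q nS by (auto simp: shattered_pairs_def pS qS PiE_def extensional_def)
      moreover have "r(j := \<theta>) = r'(j := \<theta>)" using eq by (simp add: extend_def pS qS)
      ultimately show "r i = r' i" by (metis fun_upd_other)
    qed
    ultimately show "p = q" by (simp add: pS qS)
  qed
  moreover have "extend ` (?P U \<inter> ?P L) \<subseteq> ?P G - (?P U \<union> ?P L)"
  proof
    fix p assume "p \<in> extend ` (?P U \<inter> ?P L)"
    then obtain S r where p: "p = (insert j S, r(j := \<theta>))" and Sr: "(S, r) \<in> ?P U \<inter> ?P L"
      by (auto simp: extend_def)
    have jS: "j \<notin> S" using notin Sr by blast
    have U: "shattered_at \<epsilon> r U S" and L: "shattered_at \<epsilon> r L S"
      using Sr by (auto simp: shattered_pairs_def)
    have "shattered_at \<epsilon> (r(j := \<theta>)) G (insert j S)"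
      unfolding shattered_at_def
    proof (intro allI impI)
      fix I assume I: "I \<subseteq> insert j S"
      have IS: "I - {j} \<subseteq> S" using I by auto
      show "\<exists>f\<in>G. (\<forall>y\<in>I. (r(j := \<theta>)) y + \<epsilon> \<le> f y) \<and>
                    (\<forall>y\<in>insert j S - I. f y \<le> (r(j := \<theta>)) y - \<epsilon>)"
      proof (cases "j \<in> I")
        case True
        obtain f where f: "f \<in> U" "\<And>y. y \<in> I - {j} \<Longrightarrow> f y \<ge> r y + \<epsilon>"
          "\<And>y. y \<in> S - (I - {j}) \<Longrightarrow> f y \<le> r y - \<epsilon>"
          using shattered_atD[OF U IS] by blast
        show ?thesis
          by (rule bexI[of _ f]) (use f True jS in \<open>auto simp: U_def\<close>)
      next
        case False
        obtain f where f: "f \<in> L" "\<And>y. y \<in> I - {j} \<Longrightarrow> f y \<ge> r y + \<epsilon>"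
          "\<And>y. y \<in> S - (I - {j}) \<Longrightarrow> f y \<le> r y - \<epsilon>"
          using shattered_atD[OF L IS] by blast
        show ?thesis
          by (rule bexI[of _ f]) (use f False jS in \<open>auto simp: L_def\<close>)
      qed
    qed
    moreover have "r(j := \<theta>) \<in> insert j S \<rightarrow>\<^sub>E M"
      using Sr \<theta> by (auto simp: shattered_pairs_def PiE_def extensional_def)
    ultimately have "p \<in> ?P G" using Sr j by (auto simp: p shattered_pairs_def)
    moreover have "p \<notin> ?P U"
      using lo[of "insert j S" "r(j := \<theta>)" U] \<open>\<epsilon> > 0\<close> by (force simp: p U_def)
    moreover have "p \<notin> ?P L"
      using hi[of "insert j S" "r(j := \<theta>)" L] \<open>\<epsilon> > 0\<close> by (force simp: p L_def)
    ultimately show "p \<in> ?P G - (?P U \<union> ?P L)" by blast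
  qed
  ultimately have "card (?P U \<inter> ?P L) \<le> card (?P G - (?P U \<union> ?P L))"
    using finP by (intro card_inj_on_le) auto
  moreover have "?P U \<union> ?P L \<subseteq> ?P G"
    by (simp add: shattered_pairs_mono U_def L_def)
  moreover from this have "card (?P G - (?P U \<union> ?P L)) = card (?P G) - card (?P U \<union> ?P L)"
    "card (?P U \<union> ?P L) \<le> card (?P G)"
    using finP by (auto intro: card_Diff_subset card_mono)
  moreover have "card (?P U) + card (?P L) = card (?P U \<union> ?P L) + card (?P U \<inter> ?P L)"
    using finP by (intro card_Un_Int)
  ultimately show ?thesis by linarith
qed

text \<open>Counting the triples of a point, a level and an ordered pair of functions on different sides
  of that level gives at least \<open>\<beta> * card J * N * (N - 1)\<close> for \<open>N = card G\<close>. If at each of the \<open>card J * card M\<close> choices of point and level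
  one of the two sides had fewer than \<open>\<alpha> * N\<close> members, the count would be less than
  \<open>2 * \<alpha> * N\<^sup>2 * card J * card M\<close>, that is less than \<open>\<beta> * card J * N\<^sup>2 / 2\<close>,
  which is impossible for \<open>N \<ge> 2\<close>.\<close>

lemma ex_balanced_split:
  fixes G :: "('a \<Rightarrow> real) set" and \<alpha> \<beta> \<epsilon> :: real
  assumes fin: "finite J" "finite M" "finite G" and "J \<noteq> {}" "\<beta> > 0"
    and sep: "\<And>f g. f \<in> G \<Longrightarrow> g \<in> G \<Longrightarrow> f \<noteq> g \<Longrightarrow> \<beta> * card J \<le>
       card {j \<in> J. separated_at \<epsilon> M f g j}"
    and G2: "card G \<ge> 2" and \<alpha>: "0 < \<alpha>" "\<alpha> * (4 * card M) \<le> \<beta>"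
  shows "\<exists>j\<in>J. \<exists>\<theta>\<in>M. \<alpha> * card G \<le> card {g \<in> G. g j \<ge> \<theta> + \<epsilon>} \<and>
                       \<alpha> * card G \<le> card {g \<in> G. g j \<le> \<theta> - \<epsilon>}"
proof (rule ccontr)
  assume contra: "\<not> ?thesis"
  define N where "N = real (card G)"
  have N: "N \<ge> 2" using G2 by (simp add: N_def)
  define P where "P j \<theta> f g \<longleftrightarrow> f j \<ge> \<theta> + \<epsilon> \<and> g j \<le> \<theta> - \<epsilon>" for j \<theta> and f g :: "'a \<Rightarrow> real"
  define up lo where "up j \<theta> = real (card {g \<in> G. g j \<ge> \<theta> + \<epsilon>})"
    and "lo j \<theta> = real (card {g \<in> G. g j \<le> \<theta> - \<epsilon>})" for j \<theta>
  have card_as_sum: "real (card {x \<in> A. Q x}) = (\<Sum>x\<in>A. of_bool (Q x))" if "finite A"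
    for A :: "'b set" and Q
    using that by (simp add: Int_def)
  have prod_eq: "(\<Sum>f\<in>G. \<Sum>g\<in>G. of_bool (P j \<theta> f g)) = up j \<theta> * lo j \<theta>" for j \<theta>
    unfolding up_def lo_def card_as_sum[OF fin(3)] sum_product
    by (intro sum.cong refl) (auto simp: P_def)
  have prod_less: "up j \<theta> * lo j \<theta> < \<alpha> * N\<^sup>2" if "j \<in> J" "\<theta> \<in> M" for j \<theta>
  proof -
    have le: "up j \<theta> \<le> N" "lo j \<theta> \<le> N" "0 \<le> up j \<theta>" "0 \<le> lo j \<theta>"
      using fin(3) by (auto simp: up_def lo_def N_def intro!: card_mono)
    have "up j \<theta> < \<alpha> * N \<or> lo j \<theta> < \<alpha> * N"
      using contra that unfolding up_def lo_def N_def by (auto simp: not_le)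
    then show ?thesis
    proof
      assume "up j \<theta> < \<alpha> * N"
      then have "up j \<theta> * N < \<alpha> * N * N" using N by simp
      moreover have "up j \<theta> * lo j \<theta> \<le> up j \<theta> * N" using le by (intro mult_left_mono)
      ultimately show ?thesis by (simp add: power2_eq_square)
    next
      assume "lo j \<theta> < \<alpha> * N"
      then have "N * lo j \<theta> < N * (\<alpha> * N)" using N by simp
      moreover have "up j \<theta> * lo j \<theta> \<le> N * lo j \<theta>" using le by (intro mult_right_mono)
      ultimately show ?thesis by (simp add: power2_eq_square mult_ac)
    qed
  qed
  have "M \<noteq> {}"
  proof -
    obtain f g where fg: "f \<in> G" "g \<in> G" "f \<noteq> g"
      using G2 by (metis One_nat_def Suc_1 card_le_Suc0_iff_eq fin(3) not_less_eq_eq)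
    have "\<beta> * card J > 0" using assms by (simp add: card_gt_0_iff)
    then show "M \<noteq> {}" using sep[OF fg] by (auto simp: separated_at_def)
  qed
  have J0: "real (card J) > 0" using assms by (simp add: card_gt_0_iff)
  have pair: "\<beta> * card J \<le> (\<Sum>j\<in>J. \<Sum>\<theta>\<in>M. of_bool (P j \<theta> f g) + of_bool (P j \<theta> g f))"
    if "f \<in> G" "g \<in> G - {f}" for f g
  proof -
    have "\<beta> * card J \<le> real (card {j \<in> J. \<exists>\<theta>\<in>M. P j \<theta> f g \<or> P j \<theta> g f})"
      using sep[of f g] that unfolding P_def separated_at_def by blast
    also have "\<dots> = (\<Sum>j\<in>J. of_bool (\<exists>\<theta>\<in>M. P j \<theta> f g \<or> P j \<theta> g f))"
      by (rule card_as_sum[OF fin(1)])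
    also have "\<dots> \<le> (\<Sum>j\<in>J. \<Sum>\<theta>\<in>M. of_bool (P j \<theta> f g) + of_bool (P j \<theta> g f))"
    proof (rule sum_mono)
      fix j assume "j \<in> J"
      show "of_bool (\<exists>\<theta>\<in>M. P j \<theta> f g \<or> P j \<theta> g f) \<le>
        (\<Sum>\<theta>\<in>M. of_bool (P j \<theta> f g) + of_bool (P j \<theta> g f) :: real)"
      proof (cases "\<exists>\<theta>\<in>M. P j \<theta> f g \<or> P j \<theta> g f")
        case True
        then obtain \<theta> where \<theta>: "\<theta> \<in> M" "P j \<theta> f g \<or> P j \<theta> g f" by blast
        have "(1::real) \<le> of_bool (P j \<theta> f g) + of_bool (P j \<theta> g f)" using \<theta> by auto
        also have "\<dots> \<le> (\<Sum>\<theta>\<in>M. of_bool (P j \<theta> f g) + of_bool (P j \<theta> g f))"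
          using \<theta>(1) fin(2) by (intro member_le_sum) auto
        finally show ?thesis using True by simp
      qed (auto intro: sum_nonneg)
    qed
    finally show ?thesis .
  qed
  have "N * ((N - 1) * (\<beta> * card J)) = (\<Sum>f\<in>G. \<Sum>g\<in>G - {f}. \<beta> * card J)"
    using fin(3) N by (simp add: N_def of_nat_diff)
  also have "\<dots> \<le> (\<Sum>f\<in>G. \<Sum>g\<in>G - {f}. \<Sum>j\<in>J. \<Sum>\<theta>\<in>M. of_bool (P j \<theta> f g) + of_bool (P j \<theta> g f))"
    by (intro sum_mono pair)
  also have "\<dots> \<le> (\<Sum>f\<in>G. \<Sum>g\<in>G. \<Sum>j\<in>J. \<Sum>\<theta>\<in>M. of_bool (P j \<theta> f g) + of_bool (P j \<theta> g f))"
    using fin(3) by (intro sum_mono sum_mono2) (auto intro!: sum_nonneg)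
  also have "\<dots> = (\<Sum>j\<in>J. \<Sum>\<theta>\<in>M. \<Sum>f\<in>G. \<Sum>g\<in>G. of_bool (P j \<theta> f g) + of_bool (P j \<theta> g f))"
    by (simp only: sum.swap[of _ J G] sum.swap[of _ M G])
  also have "\<dots> = (\<Sum>j\<in>J. \<Sum>\<theta>\<in>M. 2 * (up j \<theta> * lo j \<theta>))"
  proof (intro sum.cong refl)
    fix j \<theta>
    have "(\<Sum>f\<in>G. \<Sum>g\<in>G. of_bool (P j \<theta> g f)) = up j \<theta> * lo j \<theta>"
      by (subst sum.swap) (rule prod_eq)
    then show "(\<Sum>f\<in>G. \<Sum>g\<in>G. of_bool (P j \<theta> f g) + of_bool (P j \<theta> g f)) = 2 * (up j \<theta> * lo j \<theta>)"
      by (simp add: sum.distrib prod_eq)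
  qed
  also have "\<dots> < (\<Sum>j\<in>J. \<Sum>\<theta>\<in>M. 2 * (\<alpha> * N\<^sup>2))"
    using fin \<open>J \<noteq> {}\<close> \<open>M \<noteq> {}\<close> prod_less by (intro sum_strict_mono) auto
  also have "\<dots> = card J * (\<alpha> * (4 * card M)) * (N\<^sup>2 / 2)" by simp
  also have "\<dots> \<le> card J * \<beta> * (N\<^sup>2 / 2)"
    using \<alpha> by (intro mult_right_mono mult_left_mono) auto
  finally have "(card J * \<beta>) * (N * (N - 1)) < (card J * \<beta>) * (N\<^sup>2 / 2)"
    by (simp add: algebra_simps)
  then have "N * (N - 1) < N\<^sup>2 / 2"
    using J0 \<open>\<beta> > 0\<close> by (simp only: mult_less_cancel_left_pos mult_pos_pos)
  moreover have "N * 2 \<le> N * N" using N by (intro mult_left_mono) auto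
  ultimately show False by (simp add: power2_eq_square algebra_simps)
qed

text \<open>Subsets of \<open>G\<close> are separated as well as \<open>G\<close> itself, so a balanced split can be repeated \<open>D\<close> times
  before the parts become too small.\<close>

lemma exp_card_shattered_pairs:
  fixes \<alpha> \<beta> \<epsilon> :: real and J :: "'a set"
  assumes fin: "finite J" "finite M" and "J \<noteq> {}" "\<beta> > 0" "\<epsilon> > 0"
    and \<alpha>: "0 < \<alpha>" "\<alpha> \<le> 1 / 2" "\<alpha> * (4 * card M) \<le> \<beta>"
  shows "finite G \<Longrightarrow> (\<And>f g. f \<in> G \<Longrightarrow> g \<in> G \<Longrightarrow> f \<noteq> g \<Longrightarrow> \<beta> * card J \<le>
       card {j \<in> J. separated_at \<epsilon> M f g j})
     \<Longrightarrow> (1 / \<alpha>) ^ D \<le> card G \<Longrightarrow> 2 ^ D \<le> card (shattered_pairs \<epsilon> M J G)"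
proof (induction D arbitrary: G)
  case 0
  then obtain g where "g \<in> G" by fastforce
  then have "({}, \<lambda>_. undefined) \<in> shattered_pairs \<epsilon> M J G"
    by (auto simp: shattered_pairs_def shattered_at_def)
  then have "card (shattered_pairs \<epsilon> M J G) > 0"
    using finite_shattered_pairs[OF fin] by (auto simp: card_gt_0_iff)
  then show ?case by simp
next
  case (Suc D)
  have "2 \<le> 1 / \<alpha>" using \<alpha> by (simp add: field_simps)
  then have "2 * 1 \<le> 1 / \<alpha> * (1 / \<alpha>) ^ D" using \<alpha> by (intro mult_mono) auto
  then have "card G \<ge> 2" using Suc.prems(3) by simp
  then obtain j \<theta> where j: "j \<in> J" "\<theta> \<in> M"
    and U: "\<alpha> * card G \<le> card {g \<in> G. g j \<ge> \<theta> + \<epsilon>}"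
    and L: "\<alpha> * card G \<le> card {g \<in> G. g j \<le> \<theta> - \<epsilon>}"
    using ex_balanced_split[OF fin Suc.prems(1) \<open>J \<noteq> {}\<close> \<open>\<beta> > 0\<close> Suc.prems(2) _ \<alpha>(1,3)] by blast
  have "\<alpha> * (1 / \<alpha>) ^ Suc D \<le> \<alpha> * card G"
    using Suc.prems(3) \<alpha> by (intro mult_left_mono) auto
  then have *: "(1 / \<alpha>) ^ D \<le> \<alpha> * card G" using \<alpha> by simp
  have "2 ^ D \<le> card (shattered_pairs \<epsilon> M J {g \<in> G. g j \<ge> \<theta> + \<epsilon>})"
    using Suc.prems(1,2) order_trans[OF * U] by (intro Suc.IH) auto
  moreover have "2 ^ D \<le> card (shattered_pairs \<epsilon> M J {g \<in> G. g j \<le> \<theta> - \<epsilon>})"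
    using Suc.prems(1,2) order_trans[OF * L] by (intro Suc.IH) auto
  ultimately show ?case
    using card_shattered_pairs_split[OF fin \<open>\<epsilon> > 0\<close> j, of G] by simp
qed

text \<open>For \<open>c \<le> 1\<close> every pair \<open>(S, r)\<close> with \<open>card S \<le> d\<close> satisfies \<open>c ^ d \<le> c ^ card S\<close>, and the sum of
  \<open>c ^ card S\<close> over all pairs, shattered or not, is \<open>(1 + c * card M) ^ card J\<close> by the binomial theorem.
  Choosing \<open>c = d / (card M * card J)\<close> gives Sauer's bound \<open>(e * card M * card J / d) ^ d\<close>.\<close>

lemma card_shattered_pairs_le:
  fixes c :: real
  assumes fin: "finite J" "finite M" and c: "0 < c" "c \<le> 1"
    and d: "\<And>S r. (S, r) \<in> shattered_pairs \<epsilon> M J G \<Longrightarrow> card S \<le> d"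
  shows "card (shattered_pairs \<epsilon> M J G) * c ^ d \<le> exp (c * card M * card J)"
proof -
  have finS: "finite S" if "S \<in> Pow J" for S using that fin(1) by (auto intro: finite_subset)
  have finPi: "finite (S \<rightarrow>\<^sub>E M)" if "S \<in> Pow J" for S
    using that finS fin(2) by (intro finite_PiE) auto
  have "card (shattered_pairs \<epsilon> M J G) * c ^ d = (\<Sum>p\<in>shattered_pairs \<epsilon> M J G. c ^ d)" by simp
  also have "\<dots> \<le> (\<Sum>p\<in>shattered_pairs \<epsilon> M J G. c ^ card (fst p))"
    using c d by (intro sum_mono power_decreasing) force+
  also have "\<dots> \<le> (\<Sum>p\<in>Sigma (Pow J) (\<lambda>S. S \<rightarrow>\<^sub>E M). c ^ card (fst p))"
    using fin finPi c by (intro sum_mono2 finite_SigmaI shattered_pairs_subset_Sigma) auto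
  also have "\<dots> = (\<Sum>S\<in>Pow J. \<Sum>r\<in>S \<rightarrow>\<^sub>E M. c ^ card S)"
    using fin finPi by (subst sum.Sigma) (auto simp: case_prod_unfold)
  also have "\<dots> = (\<Sum>S\<in>Pow J. (\<Prod>j\<in>S. c * card M) * (\<Prod>j\<in>J - S. 1))"
    using finS by (intro sum.cong) (auto simp: card_PiE power_mult_distrib mult.commute)
  also have "\<dots> = (\<Prod>j\<in>J. c * card M + 1)"
    using fin(1) by (rule prod_add[symmetric])
  also have "\<dots> \<le> (\<Prod>j\<in>J. exp (c * card M))"
    using c exp_ge_add_one_self[of "c * card M"] by (intro prod_mono) (auto simp: add.commute)
  also have "\<dots> = exp (c * card M * card J)"
    by (simp add: exp_of_nat_mult[symmetric] mult.commute)
  finally show ?thesis .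
qed

section \<open>Extraction of a small sample\<close>

text \<open>The first moment method. For a random sequence \<open>s\<close> of \<open>k\<close> independent uniform points, the expectation of
  \<open>exp (- hits)\<close>, where \<open>hits\<close> is the number of visits of \<open>s\<close> to \<open>A\<close>, is at most \<open>exp (- p * k / 2)\<close>. If every sequence visited some \<open>A \<in> \<A>\<close>
  fewer than \<open>p * k / 4\<close> times, these expectations would add up to at least \<open>exp (- p * k / 4)\<close>, which requires
  \<open>exp (p * k / 4)\<close> sets. Expectations are written as sums over all sequences.\<close>

lemma ex_sample_hitting:
  fixes I :: "'i set" and p :: real and k :: nat
  assumes fin: "finite I" "finite \<A>" and "I \<noteq> {}" and p: "0 \<le> p"
    and large: "\<And>A. A \<in> \<A> \<Longrightarrow> A \<subseteq> I \<and> p * card I \<le> card A"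
    and few: "card \<A> < exp (p * k / 4)"
  shows "\<exists>s. s ` {..<k} \<subseteq> I \<and> (\<forall>A\<in>\<A>. p * k / 4 \<le> card {j \<in> {..<k}. s j \<in> A})"
proof (rule ccontr)
  assume contra: "\<not> ?thesis"
  define w :: "'i set \<Rightarrow> 'i \<Rightarrow> real" where "w A i = (if i \<in> A then exp (- 1) else 1)" for A i
  define T where "T = ({..<k} \<rightarrow>\<^sub>E I)"
  have finT: "finite T" using fin unfolding T_def by (intro finite_PiE) auto
  have weight: "(\<Prod>j<k. w A (s j)) = exp (- real (card {j \<in> {..<k}. s j \<in> A}))" for A s
    by (simp add: w_def prod.If_cases Int_def exp_of_nat_mult[symmetric])
  have total: "(\<Sum>s\<in>T. \<Prod>j<k. w A (s j)) \<le> card I ^ k * exp (- (p * k / 2))" if "A \<in> \<A>" for A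
  proof -
    have AI: "A \<subseteq> I" "p * card I \<le> card A" using large[OF that] by auto
    have "exp (- 1) \<le> (1 / 2 :: real)"
      using exp_ge_add_one_self[of 1] by (simp add: exp_minus field_simps)
    have "(\<Sum>i\<in>I. w A i) = card A * exp (- 1) + card (I - A)"
      using fin(1) AI(1) by (simp add: w_def sum.If_cases Int_absorb1 Diff_eq[symmetric])
    also have "\<dots> \<le> card A * (1 / 2) + (real (card I) - card A)"
      using AI fin(1) \<open>exp (- 1) \<le> (1 / 2 :: real)\<close>
      by (intro add_mono mult_left_mono)
         (auto simp: card_Diff_subset finite_subset of_nat_diff card_mono)
    also have "\<dots> \<le> card I * (1 + - (p / 2))" using AI(2) by (simp add: algebra_simps)
    also have "\<dots> \<le> card I * exp (- (p / 2))" by (intro mult_left_mono exp_ge_add_one_self) auto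
    finally have le: "(\<Sum>i\<in>I. w A i) \<le> card I * exp (- (p / 2))" .
    have "(\<Sum>s\<in>T. \<Prod>j<k. w A (s j)) = (\<Prod>j<k. \<Sum>i\<in>I. w A i)"
      unfolding T_def using fin(1) by (subst prod_sum_PiE) auto
    also have "\<dots> \<le> (card I * exp (- (p / 2))) ^ k"
      using le by (simp add: power_mono sum_nonneg w_def)
    also have "\<dots> = card I ^ k * exp (- (p * k / 2))"
      by (simp add: power_mult_distrib exp_of_nat_mult[symmetric] mult_ac)
    finally show ?thesis .
  qed
  have bad: "exp (- (p * k / 4)) \<le> (\<Sum>A\<in>\<A>. \<Prod>j<k. w A (s j))" if "s \<in> T" for s
  proof -
    have "s ` {..<k} \<subseteq> I" using that by (auto simp: T_def)
    then have "\<not> (\<forall>A\<in>\<A>. p * k / 4 \<le> card {j \<in> {..<k}. s j \<in> A})" using contra by metis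
    then obtain A where A: "A \<in> \<A>" "card {j \<in> {..<k}. s j \<in> A} < p * k / 4"
      by (meson not_le)
    then have "exp (- (p * k / 4)) \<le> (\<Prod>j<k. w A (s j))" by (simp add: weight)
    also have "\<dots> \<le> (\<Sum>A\<in>\<A>. \<Prod>j<k. w A (s j))"
      using A(1) fin(2) by (intro member_le_sum) (auto simp: weight)
    finally show ?thesis .
  qed
  have "card I ^ k * exp (- (p * k / 4)) = (\<Sum>s\<in>T. exp (- (p * k / 4)))"
    using fin by (simp add: T_def card_PiE)
  also have "\<dots> \<le> (\<Sum>s\<in>T. \<Sum>A\<in>\<A>. \<Prod>j<k. w A (s j))" by (intro sum_mono bad)
  also have "\<dots> = (\<Sum>A\<in>\<A>. \<Sum>s\<in>T. \<Prod>j<k. w A (s j))" by (rule sum.swap)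
  also have "\<dots> \<le> (\<Sum>A\<in>\<A>. card I ^ k * exp (- (p * k / 2)))" by (intro sum_mono total)
  also have "\<dots> = card I ^ k * (card \<A> * exp (- (p * k / 2)))" by simp
  finally have "exp (- (p * k / 4)) \<le> card \<A> * exp (- (p * k / 2))"
    using fin \<open>I \<noteq> {}\<close> by (simp add: card_gt_0_iff)
  also have "\<dots> < exp (p * k / 4) * exp (- (p * k / 2))" using few by simp
  also have "\<dots> = exp (- (p * k / 4))" by (simp add: exp_add[symmetric])
  finally show False by simp
qed

lemma card_far_indices_ge:
  fixes h :: "'i \<Rightarrow> real" and t :: real
  assumes "finite I" "\<And>i. i \<in> I \<Longrightarrow> \<bar>h i\<bar> \<le> 2" and sum: "card I * t\<^sup>2 \<le> (\<Sum>i\<in>I. (h i)\<^sup>2)" and "t > 0"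
  shows "t\<^sup>2 / 8 * card I \<le> card {i \<in> I. t / 2 \<le> \<bar>h i\<bar>}"
proof -
  let ?A = "{i \<in> I. t / 2 \<le> \<bar>h i\<bar>}"
  have "(\<Sum>i\<in>I. (h i)\<^sup>2) \<le> (\<Sum>i\<in>I. 4 * of_bool (t / 2 \<le> \<bar>h i\<bar>) + t\<^sup>2 / 4)"
  proof (rule sum_mono)
    fix i assume i: "i \<in> I"
    show "(h i)\<^sup>2 \<le> 4 * of_bool (t / 2 \<le> \<bar>h i\<bar>) + t\<^sup>2 / 4"
    proof (cases "t / 2 \<le> \<bar>h i\<bar>")
      case True
      have "\<bar>h i\<bar>\<^sup>2 \<le> 2\<^sup>2" using assms(2)[OF i] by (intro power_mono) auto
      then show ?thesis using True by (simp add: add_increasing2)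
    next
      case False
      then have "\<bar>h i\<bar>\<^sup>2 \<le> (t / 2)\<^sup>2" by (intro power_mono) auto
      then show ?thesis using False by (simp add: power_divide)
    qed
  qed
  also have "\<dots> = 4 * card ?A + card I * (t\<^sup>2 / 4)"
    using assms(1) by (simp add: sum.distrib sum_distrib_left[symmetric] Int_def)
  finally have "card I * t\<^sup>2 \<le> 4 * card ?A + card I * (t\<^sup>2 / 4)" using sum by linarith
  moreover have "0 \<le> card I * t\<^sup>2" by simp
  ultimately show ?thesis by (simp add: algebra_simps)
qed

text \<open>An \<open>L\<^sub>2\<close>-distance of at least \<open>t\<close> between functions of modulus at most \<open>1\<close> puts a proportion
  \<open>t\<^sup>2 / 8\<close> of the points into the set where they are \<open>t / 2\<close> apart. There are fewer than \<open>(card G)\<^sup>2\<close> such sets, so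
  a sample of size \<open>O(ln (card G) / t\<^sup>2)\<close> retains a quarter of the proportion for every pair
  at once. The sample size no longer involves \<open>n\<close>.\<close>

lemma ex_sample_keeping_distances:
  fixes G :: "('a \<Rightarrow> real) set" and x :: "nat \<Rightarrow> 'a"
  assumes "finite G" "G \<noteq> {}" "n > 0" and t: "t > 0"
    and bounded: "\<And>f i. f \<in> G \<Longrightarrow> i \<in> {1..n} \<Longrightarrow> \<bar>f (x i)\<bar> \<le> 1"
    and sep: "\<And>f g. f \<in> G \<Longrightarrow> g \<in> G \<Longrightarrow> f \<noteq> g \<Longrightarrow> n * t\<^sup>2 \<le> (\<Sum>i=1..n. (f (x i) - g (x i))\<^sup>2)"
    and k: "64 * ln (card G) / t\<^sup>2 < real k"
  shows "\<exists>s. s ` {..<k} \<subseteq> {1..n} \<and> (\<forall>f\<in>G. \<forall>g\<in>G. f \<noteq> g \<longrightarrow>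
           t\<^sup>2 / 32 * k \<le> card {j \<in> {..<k}. t / 2 \<le> \<bar>f (x (s j)) - g (x (s j))\<bar>})"
proof -
  define far where "far = (\<lambda>(f, g). {i \<in> {1..n}. t / 2 \<le> \<bar>f (x i) - g (x i)\<bar>})"
  define \<A> where "\<A> = far ` {(f, g) \<in> G \<times> G. f \<noteq> g}"
  have finpairs: "finite {(f, g) \<in> G \<times> G. f \<noteq> g}"
    using \<open>finite G\<close> by (auto intro: finite_subset[of _ "G \<times> G"])
  have "\<exists>s. s ` {..<k} \<subseteq> {1..n} \<and> (\<forall>A\<in>\<A>. t\<^sup>2 / 8 * k / 4 \<le> card {j \<in> {..<k}. s j \<in> A})"
  proof (rule ex_sample_hitting)
    show "A \<subseteq> {1..n} \<and> t\<^sup>2 / 8 * card {1..n} \<le> card A" if A: "A \<in> \<A>" for A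
    proof -
      obtain f g where fg: "f \<in> G" "g \<in> G" "f \<noteq> g" "A = far (f, g)"
        using A by (auto simp: \<A>_def)
      have "\<bar>f (x i) - g (x i)\<bar> \<le> 2" if "i \<in> {1..n}" for i
        using bounded[OF fg(1) that] bounded[OF fg(2) that] by linarith
      then have "t\<^sup>2 / 8 * card {1..n} \<le> card A"
        unfolding fg(4) far_def prod.case using sep[OF fg(1-3)] t
        by (intro card_far_indices_ge[where h = "\<lambda>i. f (x i) - g (x i)"]) auto
      then show ?thesis by (auto simp: fg(4) far_def)
    qed
    have "card \<A> \<le> card (G \<times> G)"
      unfolding \<A>_def using \<open>finite G\<close> finpairs
      by (intro order_trans[OF card_image_le] card_mono) auto
    then have "card \<A> \<le> card G * real (card G)"
      unfolding card_cartesian_product using of_nat_mono by fastforce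
    also have "\<dots> = exp (2 * ln (card G))"
    proof -
      have "card G > 0" using \<open>finite G\<close> \<open>G \<noteq> {}\<close> by (simp add: card_gt_0_iff)
      then show ?thesis unfolding mult_2 exp_add by simp
    qed
    also have "2 * ln (card G) < t\<^sup>2 / 8 * k / 4"
      using k t by (simp add: field_simps)
    finally show "card \<A> < exp (t\<^sup>2 / 8 * k / 4)" by simp
  qed (use finpairs \<open>n > 0\<close> in \<open>auto simp: \<A>_def\<close>)
  then obtain s where s: "s ` {..<k} \<subseteq> {1..n}"
    and hit: "\<And>A. A \<in> \<A> \<Longrightarrow> t\<^sup>2 / 8 * k / 4 \<le> card {j \<in> {..<k}. s j \<in> A}" by blast
  show ?thesis
  proof (intro exI conjI ballI impI)
    fix f g assume fg: "f \<in> G" "g \<in> G" "f \<noteq> g"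
    have "{j \<in> {..<k}. s j \<in> far (f, g)} = {j \<in> {..<k}. t / 2 \<le> \<bar>f (x (s j)) - g (x (s j))\<bar>}"
      using s by (auto simp: far_def)
    then show "t\<^sup>2 / 32 * k \<le> card {j \<in> {..<k}. t / 2 \<le> \<bar>f (x (s j)) - g (x (s j))\<bar>}"
      using hit[of "far (f, g)"] fg by (auto simp: \<A>_def)
  qed (rule s)
qed

section \<open>The cardinality of separated sets\<close>

text \<open>The interval between \<open>b + \<epsilon>\<close> and \<open>a - \<epsilon>\<close> has length at least \<open>2 * \<epsilon>\<close>, so it contains a multiple of \<open>\<epsilon>\<close>,
  and this multiple lies in \<open>[-1, 1]\<close>.\<close>

lemma ex_grid_level:
  fixes a b \<epsilon> :: real
  assumes "\<epsilon> > 0" "\<bar>a\<bar> \<le> 1" "\<bar>b\<bar> \<le> 1" "a - b \<ge> 4 * \<epsilon>"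
  shows "\<exists>\<theta>\<in>(\<lambda>m. real_of_int m * \<epsilon>) ` {-\<lfloor>1 / \<epsilon>\<rfloor>..\<lfloor>1 / \<epsilon>\<rfloor>}. a \<ge> \<theta> + \<epsilon> \<and> b \<le> \<theta> - \<epsilon>"
proof -
  define m where "m = \<lceil>b / \<epsilon>\<rceil> + 1"
  have "b / \<epsilon> + 1 \<le> m" "m \<le> b / \<epsilon> + 2" unfolding m_def by linarith+
  then have m: "b + \<epsilon> \<le> m * \<epsilon>" "m * \<epsilon> \<le> b + 2 * \<epsilon>" using \<open>\<epsilon> > 0\<close> by (simp_all add: field_simps)
  then have "m * \<epsilon> \<le> 1" "(- m) * \<epsilon> \<le> 1" using assms by auto
  then have "m \<le> 1 / \<epsilon>" "- m \<le> 1 / \<epsilon>" using \<open>\<epsilon> > 0\<close> by (simp_all add: field_simps)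
  then have "m \<in> {-\<lfloor>1 / \<epsilon>\<rfloor>..\<lfloor>1 / \<epsilon>\<rfloor>}" unfolding atLeastAtMost_iff by linarith
  then show ?thesis using m assms by (intro bexI[of _ "m * \<epsilon>"]) auto
qed

lemma card_grid_le:
  fixes \<epsilon> :: real
  assumes "\<epsilon> > 0"
  shows "card ((\<lambda>m. real_of_int m * \<epsilon>) ` {-\<lfloor>1 / \<epsilon>\<rfloor>..\<lfloor>1 / \<epsilon>\<rfloor>}) \<le> 2 / \<epsilon> + 1"
proof -
  have "card ((\<lambda>m. real_of_int m * \<epsilon>) ` {-\<lfloor>1 / \<epsilon>\<rfloor>..\<lfloor>1 / \<epsilon>\<rfloor>}) \<le> nat (2 * \<lfloor>1 / \<epsilon>\<rfloor> + 1)"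
    using card_image_le[of "{-\<lfloor>1 / \<epsilon>\<rfloor>..\<lfloor>1 / \<epsilon>\<rfloor>}" "\<lambda>m. real_of_int m * \<epsilon>"] by simp
  moreover have "\<lfloor>1 / \<epsilon>\<rfloor> \<ge> 0" "of_int \<lfloor>1 / \<epsilon>\<rfloor> \<le> 1 / \<epsilon>" using assms by auto
  ultimately show ?thesis by linarith
qed

text \<open>Two points of \<open>S\<close> with the same image cannot be told apart by any \<open>f \<circ> y\<close>, so repetitions among sampled points
  do not produce spurious shattered sets.\<close>

lemma shattered_image:
  fixes y :: "'i \<Rightarrow> 'a"
  assumes sh: "shattered_at \<epsilon> r ((\<lambda>f. f \<circ> y) ` G) S" and "\<epsilon> > 0"
  shows "inj_on y S" "shattered \<epsilon> G (y ` S)"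
proof -
  show inj: "inj_on y S"
  proof (rule inj_onI, rule ccontr)
    fix i j assume ij: "i \<in> S" "j \<in> S" "y i = y j" "i \<noteq> j"
    obtain f where f: "f \<in> (\<lambda>f. f \<circ> y) ` G" "\<And>z. z \<in> {i} \<Longrightarrow> f z \<ge> r z + \<epsilon>"
      "\<And>z. z \<in> S - {i} \<Longrightarrow> f z \<le> r z - \<epsilon>"
      using shattered_atD[OF sh, of "{i}"] ij by blast
    obtain g where g: "g \<in> (\<lambda>f. f \<circ> y) ` G" "\<And>z. z \<in> {j} \<Longrightarrow> g z \<ge> r z + \<epsilon>"
      "\<And>z. z \<in> S - {j} \<Longrightarrow> g z \<le> r z - \<epsilon>"
      using shattered_atD[OF sh, of "{j}"] ij by blast
    have "f i = f j" "g i = g j" using f(1) g(1) ij by auto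
    then show False using f(2)[of i] f(3)[of j] g(2)[of j] g(3)[of i] ij \<open>\<epsilon> > 0\<close> by auto
  qed
  show "shattered \<epsilon> G (y ` S)"
    unfolding shattered_def
  proof (intro exI[of _ "r \<circ> inv_into S y"] allI impI)
    fix I assume I: "I \<subseteq> y ` S"
    have "S \<inter> y -` I \<subseteq> S" by auto
    then obtain f where f: "f \<in> (\<lambda>f. f \<circ> y) ` G" "\<And>z. z \<in> S \<inter> y -` I \<Longrightarrow> f z \<ge> r z + \<epsilon>"
      "\<And>z. z \<in> S - (S \<inter> y -` I) \<Longrightarrow> f z \<le> r z - \<epsilon>"
      using shattered_atD[OF sh] by metis
    then obtain g where "g \<in> G" "f = g \<circ> y" by auto
    then show "\<exists>f\<in>G. (\<forall>z\<in>I. (r \<circ> inv_into S y) z + \<epsilon> \<le> f z) \<and>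
                      (\<forall>z\<in>y ` S - I. f z \<le> (r \<circ> inv_into S y) z - \<epsilon>)"
      using f I inj by (intro bexI[of _ g]) (auto simp: subset_iff)
  qed
qed

text \<open>The inequality \<open>u \<le> C * l * (l + ln (1 + u))\<close>, where \<open>u = L / d\<close> and \<open>l = ln v\<close>, is solved for \<open>u\<close>: the
  crude bound \<open>ln (1 + u) \<le> 2 * sqrt u\<close> makes it a quadratic inequality in \<open>sqrt u\<close>.\<close>

lemma entropy_arithmetic:
  fixes L v k d :: real
  assumes "L \<ge> 0" "d \<ge> 1" "v \<ge> 2" "k > 0"
    and D: "real D \<ge> L / (12 * ln v) - 1"
    and k: "k \<le> 16 * v\<^sup>2 * L + 1 + d"
    and pow: "real D * ln 2 \<le> d * ln (exp 1 * (17 * v / 2) * k / d)"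
  shows "L \<le> 2976 * d * (ln v)\<^sup>2"
proof -
  define u where "u = L / d"
  have u: "u \<ge> 0" and L: "L = d * u" using assms by (auto simp: u_def)
  define l where "l = ln v"
  have ln2: "1 / 2 \<le> ln (2::real)" "ln 2 \<le> (1::real)"
    using ln2_ge_two_thirds ln_add_one_self_le_self[of 1] by auto
  have l: "l \<ge> 1 / 2" using ln2 ln_mono[of 2 v] \<open>v \<ge> 2\<close> unfolding l_def by linarith
  have "k / d \<le> 16 * v\<^sup>2 * u + 2"
  proof -
    have "k \<le> d * (16 * v\<^sup>2 * u + 2)" using k \<open>d \<ge> 1\<close> by (simp add: L algebra_simps)
    then show ?thesis using \<open>d \<ge> 1\<close> by (simp add: field_simps)
  qed
  also have "\<dots> \<le> 16 * v\<^sup>2 * (1 + u)"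
  proof -
    have "2 * 2 \<le> v * v" using \<open>v \<ge> 2\<close> by (intro mult_mono) auto
    then show ?thesis by (simp add: power2_eq_square algebra_simps)
  qed
  finally have kd: "k / d \<le> 16 * v\<^sup>2 * (1 + u)" .
  have "exp 1 * (17 * v / 2) * (k / d) \<le> 3 * (17 * v / 2) * (16 * v\<^sup>2 * (1 + u))"
    using exp_le kd assms by (intro mult_mono) auto
  also have "\<dots> = 408 * (v ^ 3 * (1 + u))" by (simp add: power_numeral_reduce)
  also have "\<dots> \<le> v ^ 9 * (v ^ 3 * (1 + u))"
  proof (intro mult_right_mono)
    have "(2::real) ^ 9 \<le> v ^ 9" using \<open>v \<ge> 2\<close> by (intro power_mono) auto
    then show "408 \<le> v ^ 9" by simp
  qed (use u assms in auto)
  also have "\<dots> = v ^ 12 * (1 + u)" by (simp add: power_add[symmetric])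
  finally have "ln (exp 1 * (17 * v / 2) * k / d) \<le> ln (v ^ 12 * (1 + u))"
    using assms u by (intro ln_mono) auto
  also have "\<dots> = 12 * l + ln (1 + u)"
    using assms u by (simp add: ln_mult ln_realpow l_def)
  also have "ln (1 + u) \<le> ln ((1 + sqrt u)\<^sup>2)"
    using u by (intro ln_mono) (auto simp: power2_eq_square algebra_simps)
  also have "\<dots> = 2 * ln (1 + sqrt u)" using u by (subst ln_realpow) (auto simp: add_pos_nonneg)
  also have "\<dots> \<le> 2 * sqrt u" using u ln_add_one_self_le_self[of "sqrt u"] by simp
  finally have *: "ln (exp 1 * (17 * v / 2) * k / d) \<le> 12 * l + 2 * sqrt u" by simp
  have "(L / (12 * l) - 1) * ln 2 \<le> real D * ln 2" using D ln2 by (simp add: l_def)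
  also have "\<dots> \<le> d * (12 * l + 2 * sqrt u)"
    using pow * \<open>d \<ge> 1\<close> by (meson mult_left_mono order_trans zero_le_one)
  finally have "L / (12 * l) * ln 2 \<le> d * (12 * l + 2 * sqrt u) + ln 2" by (simp add: algebra_simps)
  also have "\<dots> \<le> d * (12 * l + 2 * sqrt u) + d * (2 * l)"
    using ln2 l \<open>d \<ge> 1\<close> mult_mono[of 1 d 1 "2 * l"] by simp
  finally have "d * (u / (12 * l) * ln 2) \<le> d * (14 * l + 2 * sqrt u)" by (simp add: L algebra_simps)
  then have "u / (12 * l) * ln 2 \<le> 14 * l + 2 * sqrt u"
    using \<open>d \<ge> 1\<close> by (simp only: mult_le_cancel_left_pos)
  moreover have "u / (12 * l) * (1 / 2) \<le> u / (12 * l) * ln 2"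
    using ln2 u l by (intro mult_left_mono) auto
  ultimately have "u / (24 * l) \<le> 14 * l + 2 * sqrt u" by simp
  then have "u \<le> 24 * l * (14 * l + 2 * sqrt u)" using l by (simp add: field_simps)
  \<comment> \<open>This square absorbs the mixed term: \<open>48 * l * sqrt u \<le> u / 2 + 1152 * l\<^sup>2\<close>.\<close>
  moreover have "0 \<le> (sqrt u - 48 * l)\<^sup>2" by simp
  ultimately have "u \<le> 2976 * l\<^sup>2" using u by (simp add: power2_eq_square algebra_simps)
  then have "d * u \<le> d * (2976 * l\<^sup>2)" using \<open>d \<ge> 1\<close> by (intro mult_left_mono) auto
  then show ?thesis by (simp add: L l_def)
qed

text \<open>With \<open>v = 2 / t\<close>, the sample has size \<open>k\<close>, about \<open>64 * L / t\<^sup>2 + d = 16 * v\<^sup>2 * L + d\<close>, and keeps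
  the proportion \<open>\<beta> = t\<^sup>2 / 32\<close>. The grid has at most \<open>17 / t = 17 * v / 2\<close> levels, which allows \<open>\<alpha> = t ^ 3 / 2176\<close>, where
  \<open>2176 = 32 * 4 * 17\<close>; then \<open>1 / \<alpha> = 272 * v ^ 3 \<le> v ^ 12\<close>.\<close>

lemma ln_card_separated_le:
  fixes G :: "('a \<Rightarrow> real) set" and x :: "nat \<Rightarrow> 'a"
  assumes "finite G" "G \<noteq> {}" "n > 0" and t: "0 < t" "t < 1" and "d > 0"
    and bounded: "\<And>f i. f \<in> G \<Longrightarrow> i \<in> {1..n} \<Longrightarrow> \<bar>f (x i)\<bar> \<le> 1"
    and sep: "\<And>f g. f \<in> G \<Longrightarrow> g \<in> G \<Longrightarrow> f \<noteq> g \<Longrightarrow> n * t\<^sup>2 \<le> (\<Sum>i=1..n. (f (x i) - g (x i))\<^sup>2)"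
    and dim: "\<And>A. finite A \<Longrightarrow> A \<subseteq> x ` {1..n} \<Longrightarrow> shattered (t / 8) G A \<Longrightarrow> card A \<le> d"
  shows "ln (card G) \<le> 2976 * d * (ln (2 / t))\<^sup>2"
proof -
  define L where "L = ln (card G)"
  define v where "v = 2 / t"
  have G1: "card G \<ge> 1" using assms by (simp add: Suc_le_eq card_gt_0_iff)
  then have L: "L \<ge> 0" "card G = exp L" by (auto simp: L_def)
  have v: "v \<ge> 2" "t = 2 / v" using t by (auto simp: v_def field_simps)
  \<comment> \<open>The summand \<open>d\<close> makes \<open>k\<close> exceed \<open>16 * v\<^sup>2 * L\<close> strictly and ensures \<open>d \<le> k\<close>, so that \<open>c \<le> 1\<close> below.\<close>
  define k where "k = nat \<lceil>16 * v\<^sup>2 * L\<rceil> + d"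
  have k: "16 * v\<^sup>2 * L < k" "k \<le> 16 * v\<^sup>2 * L + 1 + d" "k > 0" "d \<le> k"
    using L \<open>d > 0\<close> v unfolding k_def by (auto simp: of_nat_nat ceiling_less_iff) linarith+
  have "64 * ln (card G) / t\<^sup>2 = 16 * v\<^sup>2 * L" by (simp add: v_def L_def power_divide)
  then have size: "64 * ln (card G) / t\<^sup>2 < real k" using k(1) by simp
  have "\<exists>s. s ` {..<k} \<subseteq> {1..n} \<and> (\<forall>f\<in>G. \<forall>g\<in>G. f \<noteq> g \<longrightarrow>
      t\<^sup>2 / 32 * k \<le> card {j \<in> {..<k}. t / 2 \<le> \<bar>f (x (s j)) - g (x (s j))\<bar>})"
    by (rule ex_sample_keeping_distances[where x = x, OF assms(1-4)]) (fact bounded sep size)+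
  then obtain s where s: "s ` {..<k} \<subseteq> {1..n}"
    and hit_s: "\<forall>f\<in>G. \<forall>g\<in>G. f \<noteq> g \<longrightarrow>
      t\<^sup>2 / 32 * k \<le> card {j \<in> {..<k}. t / 2 \<le> \<bar>f (x (s j)) - g (x (s j))\<bar>}" by (elim exE conjE)
  define y where "y = x \<circ> s"
  define H where "H = (\<lambda>f. f \<circ> y) ` G"
  define M where "M = (\<lambda>m. real_of_int m * (t / 8)) ` {-\<lfloor>1 / (t / 8)\<rfloor>..\<lfloor>1 / (t / 8)\<rfloor>}"
  have hit: "t\<^sup>2 / 32 * k \<le> card {j \<in> {..<k}. t / 2 \<le> \<bar>f (y j) - g (y j)\<bar>}"
    if "f \<in> G" "g \<in> G" "f \<noteq> g" for f g
    using hit_s that by (simp add: y_def)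
  have "inj_on (\<lambda>f. f \<circ> y) G"
  proof (rule inj_onI, rule ccontr)
    fix f g assume fg: "f \<in> G" "g \<in> G" "f \<circ> y = g \<circ> y" "f \<noteq> g"
    have "f (y j) = g (y j)" for j using fun_cong[OF fg(3), of j] by simp
    then show False using hit[OF fg(1,2,4)] t k(3) by (simp add: mult_le_0_iff)
  qed
  then have cardH: "card H = card G" by (simp add: H_def card_image)
  have cardM: "card M \<le> 17 / t"
    using card_grid_le[of "t / 8"] t unfolding M_def by (simp add: field_simps)
  define D where "D = nat \<lfloor>L / (12 * ln v)\<rfloor>"
  have ln_v: "ln v > 0" using v by simp
  have D: "D \<le> L / (12 * ln v)" "L / (12 * ln v) - 1 \<le> D"
    using L(1) ln_v unfolding D_def by (auto simp: of_nat_nat)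
  have "2 ^ D \<le> card (shattered_pairs (t / 8) M {..<k} H)"
  proof (rule exp_card_shattered_pairs[where \<alpha> = "t ^ 3 / 2176" and \<beta> = "t\<^sup>2 / 32"])
    show "t ^ 3 / 2176 \<le> 1 / 2" using power_le_one[of t 3] t by simp
    have "t ^ 3 / 2176 * (4 * card M) \<le> t ^ 3 / 2176 * (4 * (17 / t))"
      using cardM t by (intro mult_left_mono) auto
    then show "t ^ 3 / 2176 * real (4 * card M) \<le> t\<^sup>2 / 32"
      using t by (simp add: power_numeral_reduce)
    fix f g assume fg: "f \<in> H" "g \<in> H" "f \<noteq> g"
    obtain f' g' where fg': "f' \<in> G" "g' \<in> G" "f = f' \<circ> y" "g = g' \<circ> y"
      using fg by (auto simp: H_def)
    have le1: "\<bar>h (y j)\<bar> \<le> 1" if "j < k" "h \<in> G" for j h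
      using that s bounded by (auto simp: y_def)
    have "t\<^sup>2 / 32 * card {..<k} \<le> card {j \<in> {..<k}. t / 2 \<le> \<bar>f j - g j\<bar>}"
      using hit[OF fg'(1,2)] fg fg' by auto
    also have "\<dots> \<le> card {j \<in> {..<k}. separated_at (t / 8) M f g j}"
    proof (intro of_nat_mono card_mono subsetI CollectI; clarify?)
      fix j assume j: "j < k" "t / 2 \<le> \<bar>f j - g j\<bar>"
      then consider "f j - g j \<ge> 4 * (t / 8)" | "g j - f j \<ge> 4 * (t / 8)" by linarith
      then have "separated_at (t / 8) M f g j"
        using ex_grid_level[of "t / 8" "f j" "g j"] ex_grid_level[of "t / 8" "g j" "f j"]
          t le1 j(1) fg' unfolding M_def separated_at_def by cases auto
      then show "j \<in> {..<k} \<and> separated_at (t / 8) M f g j" using j(1) by simp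
    qed simp
    finally show "t\<^sup>2 / 32 * card {..<k} \<le> card {j \<in> {..<k}. separated_at (t / 8) M f g j}" .
  next
    have "272 * v ^ 3 \<le> v ^ 9 * v ^ 3"
    proof (intro mult_right_mono)
      have "(2::real) ^ 9 \<le> v ^ 9" using v by (intro power_mono) auto
      then show "272 \<le> v ^ 9" by simp
    qed (use v in auto)
    then have "1 / (t ^ 3 / 2176) \<le> v ^ 12"
      using v by (simp add: power_divide power_add[symmetric])
    also have "\<dots> = exp (12 * ln v)" using v by (simp add: exp_of_nat_mult[of 12, simplified])
    finally have "(1 / (t ^ 3 / 2176)) ^ D \<le> exp (12 * ln v) ^ D"
      using t by (intro power_mono) auto
    also have "\<dots> = exp (D * (12 * ln v))"
      by (simp only: exp_of_nat_mult)
    also have "\<dots> \<le> exp (L / (12 * ln v) * (12 * ln v))"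
      using D(1) ln_v unfolding exp_le_cancel_iff by (intro mult_right_mono) auto
    also have "\<dots> = card H" using v by (simp add: cardH L(2))
    finally show "(1 / (t ^ 3 / 2176)) ^ D \<le> card H" .
  qed (use t k \<open>finite G\<close> in \<open>auto simp: M_def H_def\<close>)
  moreover have "card (shattered_pairs (t / 8) M {..<k} H) \<le> (exp 1 * (17 * v / 2) * k / d) ^ d"
  proof -
    define c where "c = d / (17 * v / 2 * k)"
    have c: "c > 0" using v k(3) \<open>d > 0\<close> by (simp add: c_def)
    have "1 * real d \<le> 17 * v / 2 * k" using v k(4) by (intro mult_mono) auto
    then have "c \<le> 1" using v k(3) by (simp add: c_def field_simps)
    have "card (shattered_pairs (t / 8) M {..<k} H) * c ^ d \<le> exp (c * card M * card {..<k})"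
    proof (rule card_shattered_pairs_le[OF _ _ c \<open>c \<le> 1\<close>])
      fix S r assume "(S, r) \<in> shattered_pairs (t / 8) M {..<k} H"
      then have S: "S \<subseteq> {..<k}" and sh: "shattered_at (t / 8) r ((\<lambda>f. f \<circ> y) ` G) S"
        by (auto simp: shattered_pairs_def H_def)
      have "card (y ` S) \<le> d"
        using S s t shattered_image(2)[OF sh]
        by (intro dim) (auto simp: y_def intro: finite_subset)
      then show "card S \<le> d" using shattered_image(1)[OF sh] t by (simp add: card_image)
    qed (auto simp: M_def)
    also have "\<dots> \<le> exp (c * (17 / t) * k)"
      using cardM c unfolding exp_le_cancel_iff card_lessThan
      by (intro mult_right_mono mult_left_mono) auto
    also have "c * (17 / t) * k = d" using v k(3) by (simp add: c_def)
    also have "exp d = (exp 1) ^ d" by (simp add: exp_of_nat_mult[symmetric])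
    finally have "card (shattered_pairs (t / 8) M {..<k} H) \<le> (exp 1 / c) ^ d"
      using c by (simp add: field_simps)
    then show ?thesis by (simp add: c_def mult_ac)
  qed
  ultimately have "2 ^ D \<le> (exp 1 * (17 * v / 2) * k / d) ^ d"
    by (meson of_nat_mono order_trans numeral_power_le_of_nat_cancel_iff)
  then have "ln (2 ^ D) \<le> ln ((exp 1 * (17 * v / 2) * k / d) ^ d)"
    by (intro ln_mono) auto
  then have "D * ln 2 \<le> d * ln (exp 1 * (17 * v / 2) * k / d)"
    using v k(3) \<open>d > 0\<close> by (simp add: ln_realpow)
  then show ?thesis
    unfolding L_def[symmetric] v_def[symmetric]
    using L(1) \<open>d > 0\<close> v(1) k(2,3) D(2) by (intro entropy_arithmetic[where k = k and D = D]) auto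
qed

section \<open>From separated sets to covering numbers\<close>

lemma ln_enat_mono: "N \<le> N' \<Longrightarrow> ln_enat N \<le> ln_enat N'"
  by (cases N; cases N') (auto simp: ln_enat_def)

lemma abs_le_1_of_Linf_unit_ball: "f \<in> Linf_unit_ball \<Omega> \<Longrightarrow> y \<in> \<Omega> \<Longrightarrow> \<bar>f y\<bar> \<le> 1"
  by (simp add: Linf_unit_ball_def SUP_le_iff)

lemma card_le_fat: "finite A \<Longrightarrow> A \<subseteq> \<Omega> \<Longrightarrow> shattered \<epsilon> F A \<Longrightarrow> enat (card A) \<le> fat \<Omega> \<epsilon> F"
  unfolding fat_def by (intro Sup_upper) blast

lemma covering_number_le_card:
  assumes "n > 0" "finite G"
    and "\<And>f. f \<in> F \<Longrightarrow> \<exists>g\<in>G. L2_seminorm (empirical_measure n x) (\<lambda>y. f y - g y) \<le> t"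
  shows "covering_number (empirical_measure n x) F t \<le> card G"
  unfolding covering_number_def using assms
  by (intro Inf_lower) (auto simp: L2_cball_def L2_space_empirical_measure intro!: exI[of _ G])

lemma less_L2_seminorm_iff:
  assumes "n > 0" "t \<ge> 0"
  shows "t < L2_seminorm (empirical_measure n x) f \<longleftrightarrow> n * t\<^sup>2 < (\<Sum>i=1..n. (f (x i))\<^sup>2)"
proof -
  have "t < L2_seminorm (empirical_measure n x) f \<longleftrightarrow> sqrt (t\<^sup>2) < sqrt ((\<Sum>i=1..n. (f (x i))\<^sup>2) / n)"
    using assms by (simp add: L2_seminorm_empirical_measure)
  also have "\<dots> \<longleftrightarrow> n * t\<^sup>2 < (\<Sum>i=1..n. (f (x i))\<^sup>2)"
    unfolding real_sqrt_less_iff using assms by (simp add: field_simps)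
  finally show ?thesis .
qed

lemma shattered_singleton:
  assumes "f \<in> F" "g \<in> F" "\<bar>f y - g y\<bar> \<ge> 2 * \<epsilon>"
  shows "shattered \<epsilon> F {y}"
proof -
  obtain u l where ul: "u \<in> F" "l \<in> F" "u y - l y \<ge> 2 * \<epsilon>"
    using assms by (cases "f y \<le> g y") (auto intro: that)
  show ?thesis
    unfolding shattered_def
  proof (intro exI[of _ "\<lambda>_. (u y + l y) / 2"] allI impI)
    fix I assume "I \<subseteq> {y}"
    then consider "I = {}" | "I = {y}" by blast
    then show "\<exists>h\<in>F. (\<forall>z\<in>I. (u y + l y) / 2 + \<epsilon> \<le> h z) \<and> (\<forall>z\<in>{y} - I. h z \<le> (u y + l y) / 2 - \<epsilon>)"
    proof cases
      case 1
      then show ?thesis using ul by (intro bexI[of _ l]) (auto simp: field_simps)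
    next
      case 2
      then show ?thesis using ul by (intro bexI[of _ u]) (auto simp: field_simps)
    qed
  qed
qed

text \<open>The combinatorial bound needs \<open>d > 0\<close>. This holds as soon as \<open>G\<close> has two members: they differ by more than \<open>t\<close> at
  some point, and that point alone is shattered.\<close>

lemma ln_card_separated_le_fat:
  fixes F G :: "('a \<Rightarrow> real) set"
  assumes "F \<subseteq> Linf_unit_ball \<Omega>" "x ` {1..n} \<subseteq> \<Omega>" "n > 0" and t: "0 < t" "t < 1"
    and d: "fat \<Omega> (t / 8) F = enat d"
    and G: "finite G" "G \<subseteq> F" "G \<noteq> {}"
    and sep: "\<And>f g. f \<in> G \<Longrightarrow> g \<in> G \<Longrightarrow> f \<noteq> g \<Longrightarrow>
                t < L2_seminorm (empirical_measure n x) (\<lambda>y. f y - g y)"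
  shows "ln (card G) \<le> 2976 * real d * (ln (2 / t))\<^sup>2"
proof -
  have sep': "n * t\<^sup>2 < (\<Sum>i=1..n. (f (x i) - g (x i))\<^sup>2)" if "f \<in> G" "g \<in> G" "f \<noteq> g" for f g
    using sep[OF that] less_L2_seminorm_iff[of n t x "\<lambda>y. f y - g y"] \<open>n > 0\<close> t by simp
  show ?thesis
  proof (cases "\<exists>f\<in>G. \<exists>g\<in>G. f \<noteq> g")
    case False
    then have "card G = 1" using G by (metis card_1_singleton_iff is_singletonI' is_singleton_def One_nat_def)
    then show ?thesis by simp
  next
    case True
    then obtain f g where fg: "f \<in> G" "g \<in> G" "f \<noteq> g" by blast
    have "\<exists>i\<in>{1..n}. t\<^sup>2 < (f (x i) - g (x i))\<^sup>2"
    proof (rule ccontr)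
      assume "\<not> ?thesis"
      then have "(\<Sum>i=1..n. (f (x i) - g (x i))\<^sup>2) \<le> (\<Sum>i=1..n. t\<^sup>2)"
        by (intro sum_mono) (auto simp: not_less)
      then show False using sep'[OF fg] by simp
    qed
    then obtain i where i: "i \<in> {1..n}" "t\<^sup>2 < (f (x i) - g (x i))\<^sup>2" by blast
    then have "t < \<bar>f (x i) - g (x i)\<bar>" using t abs_le_square_iff[of "f (x i) - g (x i)" t] by auto
    then have "shattered (t / 8) F {x i}"
      using fg G t by (intro shattered_singleton[of f _ g]) auto
    then have "enat 1 \<le> fat \<Omega> (t / 8) F"
      using card_le_fat[of "{x i}" \<Omega> "t / 8" F] i assms(2) by (auto simp: image_subset_iff)
    then have "d > 0" using d by simp
    show ?thesis
    proof (rule ln_card_separated_le[OF G(1,3) \<open>n > 0\<close> t \<open>d > 0\<close>])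
      show "\<bar>f (x i)\<bar> \<le> 1" if "f \<in> G" "i \<in> {1..n}" for f i
        using that assms(1,2) G(2) by (intro abs_le_1_of_Linf_unit_ball[of f \<Omega>]) auto
      show "n * t\<^sup>2 \<le> (\<Sum>i=1..n. (f (x i) - g (x i))\<^sup>2)" if "f \<in> G" "g \<in> G" "f \<noteq> g" for f g
        using sep'[OF that] by simp
      show "card A \<le> d" if A: "finite A" "A \<subseteq> x ` {1..n}" "shattered (t / 8) G A" for A
      proof -
        have "shattered (t / 8) F A"
          using A(3) G(2) shattered_at_mono unfolding shattered_iff_shattered_at by blast
        then show ?thesis using card_le_fat[of A \<Omega> "t / 8" F] A assms(2) d by auto
      qed
    qed
  qed
qed

lemma entropy_bound_2976: "entropy_bound 2976 \<Omega>"
  unfolding entropy_bound_def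
proof (intro allI impI)
  fix F :: "('a \<Rightarrow> real) set" and n :: nat and x :: "nat \<Rightarrow> 'a" and t :: real
  assume F: "F \<subseteq> Linf_unit_ball \<Omega>" and n: "n > 0" and x: "x ` {1..n} \<subseteq> \<Omega>" and t: "t > 0"
  let ?\<mu> = "empirical_measure n x"
  show "ln_enat (covering_number ?\<mu> F t) \<le> ereal 2976 * ereal_of_enat (fat \<Omega> (t / 8) F) * ereal ((ln (2 / t))\<^sup>2)"
  proof (cases "t < 1")
    case False
    have "covering_number ?\<mu> F t \<le> card {\<lambda>_::'a. 0::real}"
    proof (intro covering_number_le_card bexI[of _ "\<lambda>_. 0"])
      fix f assume f: "f \<in> F"
      have "(\<Sum>i=1..n. (f (x i))\<^sup>2) \<le> (\<Sum>i=1..n. 1)"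
      proof (rule sum_mono)
        fix i assume "i \<in> {1..n}"
        then have "\<bar>f (x i)\<bar> \<le> 1" using F f x by (blast intro: abs_le_1_of_Linf_unit_ball)
        then show "(f (x i))\<^sup>2 \<le> 1" by (simp add: abs_square_le_1)
      qed
      also have "\<dots> \<le> n * t\<^sup>2" using False mult_left_mono[of 1 "t\<^sup>2" "real n"] by simp
      finally show "L2_seminorm ?\<mu> (\<lambda>y. f y - 0) \<le> t"
        using less_L2_seminorm_iff[of n t x f] n t by (simp add: not_less[symmetric])
    qed (use n in auto)
    then have "ln_enat (covering_number ?\<mu> F t) \<le> ln_enat (enat 1)" using ln_enat_mono by fastforce
    also have "\<dots> \<le> ereal 2976 * ereal_of_enat (fat \<Omega> (t / 8) F) * ereal ((ln (2 / t))\<^sup>2)"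
      by (simp add: ln_enat_def zero_ereal_def[symmetric] ereal_of_enat_nonneg)
    finally show ?thesis .
  next
    case True
    then have ln0: "ln (2 / t) > 0" using t by simp
    show ?thesis
    proof (cases "fat \<Omega> (t / 8) F")
      case infinity
      then show ?thesis using ln0 by simp
    next
      case (enat d)
      define sep where "sep G \<longleftrightarrow> finite G \<and> G \<subseteq> F \<and>
        (\<forall>f\<in>G. \<forall>g\<in>G. f \<noteq> g \<longrightarrow> t < L2_seminorm ?\<mu> (\<lambda>y. f y - g y))" for G
      have bound: "ln (card G) \<le> 2976 * real d * (ln (2 / t))\<^sup>2" if "sep G" "G \<noteq> {}" for G
        using that True by (intro ln_card_separated_le_fat[OF F x n t True enat]) (auto simp: sep_def)
      have "card G \<le> nat \<lfloor>exp (2976 * real d * (ln (2 / t))\<^sup>2)\<rfloor>" if "sep G" for G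
      proof (cases "G = {}")
        case nonempty: False
        then have "0 < real (card G)" using that by (simp add: sep_def card_gt_0_iff)
        then have "real (card G) \<le> exp (2976 * real d * (ln (2 / t))\<^sup>2)"
          using bound[OF that nonempty] by (metis exp_le_cancel_iff exp_ln)
        then show ?thesis by (simp add: le_nat_floor)
      qed simp
      moreover have "sep {}" by (simp add: sep_def)
      \<comment> \<open>The bound holds for all finite separated sets, so one of them has the largest cardinality; it is a \<open>t\<close>-net.\<close>
      ultimately obtain G where G: "sep G" and max: "\<And>G'. sep G' \<Longrightarrow> card G' \<le> card G"
        using ex_has_greatest_nat[of sep "{}" card] by (metis le_imp_less_Suc)
      have "covering_number ?\<mu> F t \<le> card G"
      proof (rule covering_number_le_card)
        fix f assume f: "f \<in> F"
        show "\<exists>g\<in>G. L2_seminorm ?\<mu> (\<lambda>y. f y - g y) \<le> t"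
        proof (rule ccontr)
          assume far: "\<not> ?thesis"
          have sym: "L2_seminorm ?\<mu> (\<lambda>y. g y - f y) = L2_seminorm ?\<mu> (\<lambda>y. f y - g y)" for g
            by (simp add: L2_seminorm_def power2_commute)
          have "f \<notin> G"
            using far t by (auto simp: L2_seminorm_def dest: bspec[of _ _ f])
          moreover have "sep (insert f G)"
            using G f far by (auto simp: sep_def sym not_le)
          ultimately show False using max[of "insert f G"] G by (simp add: sep_def)
        qed
      qed (use n G in \<open>auto simp: sep_def\<close>)
      then have "ln_enat (covering_number ?\<mu> F t) \<le> ln_enat (card G)" by (rule ln_enat_mono)
      also have "\<dots> \<le> ereal (2976 * real d * (ln (2 / t))\<^sup>2)"
        using bound[OF G] G by (cases "G = {}") (auto simp: ln_enat_def sep_def)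
      also have "\<dots> = ereal 2976 * ereal_of_enat (fat \<Omega> (t / 8) F) * ereal ((ln (2 / t))\<^sup>2)"
        by (simp add: enat)
      finally show ?thesis .
    qed
  qed
qed

section \<open>Transfer to arbitrary types\<close>

lemma fat_pullback_le:
  assumes "\<epsilon> > 0" "y ` \<Omega>' \<subseteq> \<Omega>"
  shows "fat \<Omega>' \<epsilon> ((\<lambda>f. f \<circ> y) ` F) \<le> fat \<Omega> \<epsilon> F"
  unfolding fat_def[of \<Omega>']
proof (rule Sup_least, clarify)
  fix A assume A: "finite A" "A \<subseteq> \<Omega>'" "shattered \<epsilon> ((\<lambda>f. f \<circ> y) ` F) A"
  then obtain \<gamma> where sh: "shattered_at \<epsilon> \<gamma> ((\<lambda>f. f \<circ> y) ` F) A"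
    by (auto simp: shattered_iff_shattered_at)
  have "enat (card (y ` A)) \<le> fat \<Omega> \<epsilon> F"
    using A assms shattered_image(2)[OF sh] by (intro card_le_fat) auto
  then show "enat (card A) \<le> fat \<Omega> \<epsilon> F"
    using shattered_image(1)[OF sh assms(1)] by (simp add: card_image)
qed

text \<open>Each sample point \<open>x i\<close> is represented by the index \<open>\<sigma> (x i)\<close>, and \<open>F\<close> by its pullback along \<open>x\<close>. Composition
  with \<open>\<sigma>\<close> turns centres for the pullback into centres for \<open>F\<close> at the same distances, and
  pulling back does not increase the fat-shattering dimension.\<close>

lemma entropy_bound_of_nat:
  fixes \<Omega> :: "'a set"
  assumes "C > 0" and nat: "\<And>\<Omega>' :: nat set. entropy_bound C \<Omega>'"
  shows "entropy_bound C \<Omega>"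
  unfolding entropy_bound_def
proof (intro allI impI)
  fix F :: "('a \<Rightarrow> real) set" and n :: nat and x :: "nat \<Rightarrow> 'a" and t :: real
  assume F: "F \<subseteq> Linf_unit_ball \<Omega>" and n: "n > 0" and x: "x ` {1..n} \<subseteq> \<Omega>" and t: "t > 0"
  define \<sigma> where "\<sigma> = inv_into {1..n} x"
  define x' where "x' = \<sigma> \<circ> x"
  define F' where "F' = (\<lambda>f. f \<circ> x) ` F"
  define \<Omega>' where "\<Omega>' = x' ` {1..n}"
  have xx': "x (x' i) = x i" if "i \<in> {1..n}" for i
    using that unfolding x'_def \<sigma>_def comp_def by (intro f_inv_into_f) auto
  have x\<Omega>': "x ` \<Omega>' \<subseteq> \<Omega>" using x xx' by (auto simp: \<Omega>'_def)
  have F': "F' \<subseteq> Linf_unit_ball \<Omega>'"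
    using abs_le_1_of_Linf_unit_ball F x\<Omega>'
    by (fastforce simp: F'_def Linf_unit_ball_def SUP_le_iff)
  have "covering_number (empirical_measure n x) F t \<le> covering_number (empirical_measure n x') F' t"
    unfolding covering_number_def[of "empirical_measure n x'"]
  proof (rule Inf_greatest, clarify)
    fix G assume G: "finite G" "F' \<subseteq> (\<Union>g\<in>G. L2_cball (empirical_measure n x') g t)"
    have "covering_number (empirical_measure n x) F t \<le> card ((\<lambda>g. g \<circ> \<sigma>) ` G)"
    proof (rule covering_number_le_card)
      fix f assume "f \<in> F"
      then have "f \<circ> x \<in> F'" by (simp add: F'_def)
      then obtain g where g: "g \<in> G" "L2_seminorm (empirical_measure n x') (\<lambda>y. (f \<circ> x) y - g y) \<le> t"
        using G(2) by (auto simp: L2_cball_def)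
      have "L2_seminorm (empirical_measure n x') (\<lambda>y. (f \<circ> x) y - g y) =
            L2_seminorm (empirical_measure n x) (\<lambda>y. f y - (g \<circ> \<sigma>) y)"
        using n xx' by (simp add: L2_seminorm_empirical_measure) (simp add: x'_def)
      then show "\<exists>g\<in>(\<lambda>g. g \<circ> \<sigma>) ` G. L2_seminorm (empirical_measure n x) (\<lambda>y. f y - g y) \<le> t"
        using g by auto
    qed (use n G in auto)
    also have "\<dots> \<le> card G" using G(1) by (simp add: card_image_le)
    finally show "covering_number (empirical_measure n x) F t \<le> card G" .
  qed
  then have "ln_enat (covering_number (empirical_measure n x) F t)
      \<le> ln_enat (covering_number (empirical_measure n x') F' t)" by (rule ln_enat_mono)
  also have "\<dots> \<le> ereal C * ereal_of_enat (fat \<Omega>' (t / 8) F') * ereal ((ln (2 / t))\<^sup>2)"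
    using nat[of \<Omega>'] F' n t unfolding entropy_bound_def \<Omega>'_def by blast
  also have "\<dots> \<le> ereal C * ereal_of_enat (fat \<Omega> (t / 8) F) * ereal ((ln (2 / t))\<^sup>2)"
    using fat_pullback_le[of "t / 8" x \<Omega>' \<Omega> F] t x\<Omega>' \<open>C > 0\<close>
    by (intro ereal_mult_right_mono ereal_mult_left_mono) (auto simp: F'_def)
  finally show "ln_enat (covering_number (empirical_measure n x) F t)
      \<le> ereal C * ereal_of_enat (fat \<Omega> (t / 8) F) * ereal ((ln (2 / t))\<^sup>2)" .
qed

theorem theorem5p5:
  shows "(\<exists>C>0. \<forall>\<Omega> :: nat set. entropy_bound C \<Omega>) \<and>
         (\<forall>C>0. (\<forall>\<Omega> :: nat set. entropy_bound C \<Omega>) \<longrightarrow> (\<forall>\<Omega> :: 'a set. entropy_bound C \<Omega>))"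
proof (intro conjI allI impI)
  show "\<exists>C>0. \<forall>\<Omega> :: nat set. entropy_bound C \<Omega>"
    using entropy_bound_2976 by (intro exI[of _ 2976]) auto
next
  fix C :: real and \<Omega> :: "'a set"
  assume "C > 0" "\<forall>\<Omega> :: nat set. entropy_bound C \<Omega>"
  then show "entropy_bound C \<Omega>" using entropy_bound_of_nat by blast
qed

end
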